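(* Let $v\ge 4$ be a multiple of $3$. The hypergraph $K_v^{(3)}-I$ admits a decomposition into tight $9$-cycles if and only if $v\ge 9$.
   Context: $K_v^{(3)}$ denotes the complete $3$-uniform hypergraph on $v$ vertices (all $3$-element subsets of the vertex set are edges). For $3\mid v$, $K_v^{(3)}-I$ denotes the hypergraph obtained from $K_v^{(3)}$ by deleting the edges of a $1$-factor $I$, i.e. a set of $v/3$ pairwise disjoint triples covering all vertices (the choice of $I$ is irrelevant up to isomorphism). A (3-uniform tight) $k$-cycle is given by a cyclic sequence $v_1,v_2,\dots,v_k$ of $k$ distinct vertices, its edges being the $k$ triples $\{v_i,v_{i+1},v_{i+2}\}$, $i=1,\dots,k$, with indices taken modulo $k$. A decomposition of a hypergraph $\mathcal H$ into $k$-cycles is a collection of $k$-cycles (sub-hypergraphs of $\mathcal H$) whose edge sets partition the edge set of $\mathcal H$. *)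

theory Defs
  imports Main
begin

definition complete3 :: "'a set \<Rightarrow> 'a set set" where
  "complete3 V = {e. e \<subseteq> V \<and> card e = 3}"

definition one_factor :: "'a set \<Rightarrow> 'a set set \<Rightarrow> bool" where
  "one_factor V I \<longleftrightarrow> I \<subseteq> complete3 V \<and>
     (\<forall>A\<in>I. \<forall>B\<in>I. A \<noteq> B \<longrightarrow> A \<inter> B = {}) \<and> \<Union>I = V"

definition is_tight_cycle :: "nat \<Rightarrow> 'a list \<Rightarrow> bool" where
  "is_tight_cycle k c \<longleftrightarrow> length c = k \<and> distinct c"

definition cycle_edges :: "'a list \<Rightarrow> 'a set set" where
  "cycle_edges c = {{c ! i, c ! ((i + 1) mod length c), c ! ((i + 2) mod length c)} | i. i < length c}"

definition cycle_decomposition :: "nat \<Rightarrow> 'a set \<Rightarrow> 'a set set \<Rightarrow> 'a list list \<Rightarrow> bool" where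
  "cycle_decomposition k V E Cs \<longleftrightarrow>
     (\<forall>c\<in>set Cs. is_tight_cycle k c \<and> set c \<subseteq> V \<and> cycle_edges c \<subseteq> E) \<and>
     (\<forall>i<length Cs. \<forall>j<length Cs. i \<noteq> j \<longrightarrow> cycle_edges (Cs ! i) \<inter> cycle_edges (Cs ! j) = {}) \<and>
     (\<Union>c\<in>set Cs. cycle_edges c) = E"

end

theory Submission
  imports Defs
begin

text \<open>
  Write v = 3n and call the n triples of I groups. An edge of the hypergraph meets two or three
  groups; the set of groups it meets is its support, a 2- or 3-subset of the n groups. A family of
  supports is good if the edges with support in it decompose into tight 9-cycles, and disjoint
  unions of good families are good. A single 3-set is good (the complete tripartite hypergraph on
  parts of size 3 splits into three 9-cycles), so it suffices to find disjoint good families that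
  together contain all 2-subsets.

  Two tight 9-cycle gadgets on four groups a, b, i, j are used: one covers the pairs ai, aj, bi, bj,
  the other all pairs except ij; both use all four 3-subsets. Passing from n to n + 2 groups, let a
  and b be the new groups. If n is odd, pair up all old groups but one, z, use the first gadget on
  a, b and each pair, and decompose all edges on the groups a, b, z. If n is even, pair up the old
  groups and use the second gadget for one of the pairs and the first for the others. The induction
  starts with n = 1 (no edges) and n = 4.
\<close>

section \<open>Edge sets that split into tight 9-cycles\<close>

text \<open>No vertex set is carried along, and disjointness is demanded only of the newly added
  cycle, so closure under disjoint unions and injective images follows by rule induction.\<close>

inductive decomposable :: "'a set set \<Rightarrow> bool" where
  empty: "decomposable {}"
| cycle: "is_tight_cycle 9 c \<Longrightarrow> decomposable E \<Longrightarrow> cycle_edges c \<inter> E = {} \<Longrightarrow>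
    decomposable (cycle_edges c \<union> E)"

lemma decomposable_Un:
  "decomposable E \<Longrightarrow> decomposable F \<Longrightarrow> E \<inter> F = {} \<Longrightarrow> decomposable (E \<union> F)"
proof (induction rule: decomposable.induct)
  case (cycle c E)
  have "decomposable (cycle_edges c \<union> (E \<union> F))"
    using cycle by (intro decomposable.cycle) auto
  then show ?case by (simp add: Un_assoc)
qed simp

lemma cycle_edges_conv_image:
  "cycle_edges c = (\<lambda>i. {c ! i, c ! ((i + 1) mod length c), c ! ((i + 2) mod length c)}) ` {..<length c}"
  unfolding cycle_edges_def by auto

lemma cycle_edges_map: "cycle_edges (map f c) = (`) f ` cycle_edges c"
proof -
  have "j mod length c < length c" if "i < length c" for i j
    using that by (intro mod_less_divisor) auto
  then show ?thesis
    unfolding cycle_edges_conv_image image_image by (intro image_cong) simp_all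
qed

lemma Union_cycle_edges: "\<Union> (cycle_edges c) = set c"
proof
  show "\<Union> (cycle_edges c) \<subseteq> set c"
    unfolding cycle_edges_def by (fastforce intro!: nth_mem mod_less_divisor)
  show "set c \<subseteq> \<Union> (cycle_edges c)"
    unfolding cycle_edges_conv_image by (force simp: in_set_conv_nth)
qed

lemma decomposable_image:
  "decomposable E \<Longrightarrow> inj_on f (\<Union>E) \<Longrightarrow> decomposable ((`) f ` E)"
proof (induction rule: decomposable.induct)
  case (cycle c E)
  have inj: "inj_on f (set c)" "inj_on f (\<Union>E)"
    using cycle.prems by (auto simp: Union_cycle_edges intro: inj_on_subset)
  have inj2: "inj_on ((`) f) (cycle_edges c \<union> E)"
    using cycle.prems by (rule inj_on_image)
  have "cycle_edges (map f c) \<inter> (`) f ` E = {}"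
    using inj2 cycle.hyps(3) unfolding cycle_edges_map
    by (metis Un_upper1 Un_upper2 image_empty inj_on_image_Int)
  moreover have "is_tight_cycle 9 (map f c)"
    using cycle.hyps inj by (simp add: is_tight_cycle_def distinct_map)
  ultimately show ?case
    using cycle.IH inj by (simp add: image_Un decomposable.cycle flip: cycle_edges_map)
qed (simp add: decomposable.empty)

text \<open>The edges of a cycle cover its vertices, so a cycle whose edges lie in
  \<open>complete3 V\<close> has all its vertices in \<open>V\<close>.\<close>

lemma decomposable_imp_cycle_decomposition:
  assumes "decomposable E" "E \<subseteq> complete3 V"
  shows "\<exists>Cs. cycle_decomposition 9 V E Cs"
  using assms
proof (induction rule: decomposable.induct)
  case empty
  then show ?case by (intro exI[of _ "[]"]) (simp add: cycle_decomposition_def)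
next
  case (cycle c E)
  then obtain Cs where Cs: "cycle_decomposition 9 V E Cs" by auto
  have "set c \<subseteq> V"
    using cycle.prems by (fastforce simp: complete3_def simp flip: Union_cycle_edges)
  moreover have "cycle_edges c \<inter> cycle_edges (Cs ! i) = {}" if "i < length Cs" for i
    using cycle.hyps(3) Cs nth_mem[OF that] unfolding cycle_decomposition_def by blast
  ultimately have "cycle_decomposition 9 V (cycle_edges c \<union> E) (c # Cs)"
    using Cs cycle.hyps(1) unfolding cycle_decomposition_def
    by (auto simp: nth_Cons Int_commute split: nat.splits)
  then show ?case ..
qed

section \<open>Supports of edges, and families of supports\<close>

text \<open>The vertex \<open>(i, t)\<close> is the \<open>t\<close>-th element of the \<open>i\<close>-th group.\<close>

definition lift :: "'i set set \<Rightarrow> ('i \<times> nat) set set" where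
  "lift \<S> = {e. card e = 3 \<and> snd ` e \<subseteq> {..<3} \<and> fst ` e \<in> \<S>}"

lemma Union_lift: "\<Union> (lift \<S>) \<subseteq> \<Union>\<S> \<times> {..<3}"
proof clarify
  fix e i t assume "e \<in> lift \<S>" and it: "(i, t) \<in> e"
  then have "fst ` e \<in> \<S>" "snd ` e \<subseteq> {..<3}" by (simp_all add: lift_def)
  then show "i \<in> \<Union>\<S> \<and> t \<in> {..<3}"
    using imageI[OF it, of fst] imageI[OF it, of snd] by auto
qed

text \<open>Renaming the groups renames the vertices while keeping their positions inside the
  groups; this lets a gadget on fixed groups be moved to arbitrary ones.\<close>

lemma lift_image:
  assumes "inj_on f (\<Union>\<S>)"
  shows "lift ((`) f ` \<S>) = (`) (map_prod f id) ` lift \<S>"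
proof (intro subset_antisym subsetI)
  fix e assume "e \<in> (`) (map_prod f id) ` lift \<S>"
  then obtain d where d: "d \<in> lift \<S>" "e = map_prod f id ` d" by auto
  have "inj_on (map_prod f id) (\<Union> (lift \<S>))"
    using inj_on_subset[OF map_prod_inj_on[OF assms, of id "{..<3}"] Union_lift] by simp
  then have "card e = card d"
    using d by (metis Union_upper card_image inj_on_subset)
  with d show "e \<in> lift ((`) f ` \<S>)"
    by (auto simp: lift_def image_image)
next
  fix e assume "e \<in> lift ((`) f ` \<S>)"
  then obtain S where e: "card e = 3" "snd ` e \<subseteq> {..<3}" and S: "S \<in> \<S>" "fst ` e = f ` S"
    by (auto simp: lift_def)
  \<comment> \<open>The pullback of \<open>e\<close> is cut down to \<open>S\<close>, since
    \<open>f\<close> is injective only on the given groups.\<close>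
  define d where "d = {(i, t). i \<in> S \<and> (f i, t) \<in> e}"
  have ed: "e = map_prod f id ` d"
  proof (intro subset_antisym subsetI)
    fix x assume "x \<in> e"
    moreover from this have "fst x \<in> f ` S" using S(2) by blast
    ultimately show "x \<in> map_prod f id ` d"
      by (cases x) (force simp: d_def)
  qed (auto simp: d_def)
  have "inj_on f S"
    using assms S(1) by (meson Union_upper inj_on_subset)
  then have "inj_on (map_prod f id) d"
    by (auto simp: d_def inj_on_def)
  then have "card d = 3"
    using e ed card_image by metis
  moreover have "fst ` d = S"
  proof -
    have "i \<in> fst ` d" if "i \<in> S" for i
    proof -
      from that S obtain t where "(f i, t) \<in> e" by (metis (no_types) imageE imageI prod.collapse)
      with that show ?thesis by (force simp: d_def)
    qed
    then show ?thesis by (auto simp: d_def)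
  qed
  moreover have "snd ` d \<subseteq> {..<3}"
    using e by (force simp: d_def)
  ultimately show "e \<in> (`) (map_prod f id) ` lift \<S>"
    using S ed by (auto simp: lift_def)
qed

definition good :: "'i set set \<Rightarrow> bool" where
  "good \<S> \<longleftrightarrow> decomposable (lift \<S>)"

lemma good_image:
  assumes "good \<S>" "inj_on f (\<Union>\<S>)"
  shows "good ((`) f ` \<S>)"
proof -
  have "inj_on (map_prod f id) (\<Union> (lift \<S>))"
    using inj_on_subset[OF map_prod_inj_on[OF assms(2), of id "{..<3}"] Union_lift] by simp
  then show ?thesis
    using assms by (simp add: good_def lift_image decomposable_image)
qed

text \<open>An edge has exactly one support, so disjoint families have disjoint edge sets.\<close>

lemma good_Un:
  assumes "good \<S>" "good \<T>" "\<S> \<inter> \<T> = {}"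
  shows "good (\<S> \<union> \<T>)"
proof -
  have "lift (\<S> \<union> \<T>) = lift \<S> \<union> lift \<T>" "lift \<S> \<inter> lift \<T> = {}"
    using assms(3) by (auto simp: lift_def)
  then show ?thesis
    using assms by (simp add: good_def decomposable_Un)
qed

lemma good_empty: "good {}"
  by (simp add: good_def lift_def decomposable.empty)


section \<open>Verifying explicit cycle systems by evaluation\<close>

text \<open>Edges are represented by sorted lists, so that equality of edges becomes equality of
  lists and can be evaluated.\<close>

definition cycle_triples :: "nat list \<Rightarrow> nat list list" where
  "cycle_triples c = map (\<lambda>i. sort [c ! i, c ! ((i + 1) mod length c), c ! ((i + 2) mod length c)]) [0..<length c]"

definition sorted_triples :: "nat \<Rightarrow> nat list list" where
  "sorted_triples N = [[x, y, z]. z \<leftarrow> [0..<N], y \<leftarrow> [0..<z], x \<leftarrow> [0..<y]]"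

text \<open>A gadget on m groups has the vertices 0, ..., 3m - 1, with x in group
  \<open>x mod m\<close>; the sorted list of occurring residues represents the support.\<close>

definition supported_in :: "nat \<Rightarrow> nat list list \<Rightarrow> nat list \<Rightarrow> bool" where
  "supported_in m Ss e \<longleftrightarrow> remdups (sort (map (\<lambda>x. x mod m) e)) \<in> set Ss"

text \<open>
  Coverage of all triples with the given supports is not tested: it follows from the final
  comparison of lengths, because the triples of the cycles are distinct.
\<close>

definition gadget :: "nat \<Rightarrow> nat list list \<Rightarrow> nat list list \<Rightarrow> bool" where
  "gadget m Ss cs \<longleftrightarrow>
    list_all (\<lambda>S. sorted S \<and> distinct S \<and> list_all (\<lambda>x. x < m) S) Ss \<and>
    list_all (\<lambda>c. length c = 9 \<and> distinct c \<and> list_all (\<lambda>x. x < 3 * m) c) cs \<and>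
    (let es = concat (map cycle_triples cs) in distinct es \<and> list_all (supported_in m Ss) es \<and>
      length es = length (filter (supported_in m Ss) (sorted_triples (3 * m))))"

definition shifts :: "nat \<Rightarrow> nat list \<Rightarrow> nat list \<Rightarrow> nat list list" where
  "shifts N ts c = map (\<lambda>t. map (\<lambda>x. (x + t) mod N) c) ts"

lemma set_cycle_triples: "set ` set (cycle_triples c) = cycle_edges c"
  unfolding cycle_triples_def cycle_edges_conv_image
  by (auto simp: image_image lessThan_atLeast0 simp del: sort_key_simps)

lemma cycle_triples_sorted:
  assumes "is_tight_cycle 9 c" "e \<in> set (cycle_triples c)"
  shows "sorted e \<and> distinct e \<and> length e = 3 \<and> set e \<subseteq> set c"
proof -
  have c: "length c = 9" "distinct c"
    using assms(1) by (auto simp: is_tight_cycle_def)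
  from assms(2) c(1) obtain i where i: "i < 9"
    and e: "e = sort [c ! i, c ! ((i + 1) mod 9), c ! ((i + 2) mod 9)]"
    by (auto simp: cycle_triples_def simp del: sort_key_simps)
  have "i \<noteq> (i + 1) mod 9" "i \<noteq> (i + 2) mod 9" "(i + 1) mod 9 \<noteq> (i + 2) mod 9"
    using i by presburger+
  then have "distinct [c ! i, c ! ((i + 1) mod 9), c ! ((i + 2) mod 9)]"
    using c i by (simp add: nth_eq_iff_index_eq)
  then have "distinct e"
    unfolding e by (simp only: distinct_sort)
  moreover have "set e \<subseteq> set c"
    unfolding e set_sort using c i by simp
  ultimately show ?thesis
    unfolding e by (simp only: sorted_sort length_sort) simp
qed

lemma set_sorted_triples:
  "set (sorted_triples N) = {e. sorted e \<and> distinct e \<and> length e = 3 \<and> set e \<subseteq> {..<N}}"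
proof -
  have "[x, y, z] \<in> set (sorted_triples N)" if "x < y" "y < z" "z < N" for x y z
    unfolding sorted_triples_def set_concat set_map image_image UN_iff
    using that by (intro bexI[of _ z] bexI[of _ y] UN_I[of y] imageI) simp_all
  then show ?thesis
    by (auto simp: length_Suc_conv eval_nat_numeral) (auto simp: sorted_triples_def)
qed

lemma inj_on_set_sorted: "inj_on set {e. sorted e \<and> distinct e}"
  by (auto simp: inj_on_def intro: sorted_distinct_set_unique)

text \<open>On sorted distinct lists \<open>set\<close> is injective, so distinctness of the
  concatenated lists says both that the cycles are edge-disjoint and that nothing is lost on passing
  to sets.\<close>

lemma decomposable_cycle_triples:
  assumes "\<forall>c\<in>set cs. is_tight_cycle 9 c" "distinct (concat (map cycle_triples cs))"
  shows "decomposable (set ` set (concat (map cycle_triples cs)))"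
  using assms
proof (induction cs)
  case (Cons c cs)
  let ?E = "set (concat (map cycle_triples cs))"
  have "?E \<union> set (cycle_triples c) \<subseteq> {e. sorted e \<and> distinct e}"
    using Cons.prems(1) cycle_triples_sorted by fastforce
  then have "cycle_edges c \<inter> set ` ?E = set ` (set (cycle_triples c) \<inter> ?E)"
    unfolding set_cycle_triples[symmetric]
    by (intro inj_on_image_Int[OF inj_on_set_sorted, symmetric]) auto
  then have "cycle_edges c \<inter> set ` ?E = {}"
    using Cons.prems(2) by simp
  then have "decomposable (cycle_edges c \<union> set ` ?E)"
    using Cons by (intro decomposable.cycle) simp_all
  then show ?case
    by (simp add: image_Un set_cycle_triples)
qed (simp add: decomposable.empty)

text \<open>Remainder and quotient modulo m identify the numbers below 3m with m groups of three
  vertices.\<close>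

lemma lift_conv_image:
  fixes \<S> :: "nat set set"
  assumes "\<Union>\<S> \<subseteq> {..<m}"
  shows "lift \<S> = (`) (\<lambda>x. (x mod m, x div m)) ` {e. card e = 3 \<and> e \<subseteq> {..<3 * m} \<and> (\<lambda>x. x mod m) ` e \<in> \<S>}"
    (is "_ = (`) ?f ` ?E")
proof (intro subset_antisym subsetI)
  have inj: "inj ?f"
    by (rule injI) (metis Pair_inject div_mult_mod_eq)
  fix e
  { assume "e \<in> (`) ?f ` ?E"
    then obtain d where d: "d \<in> ?E" "e = ?f ` d" by auto
    have "x div m < 3" if "x \<in> d" for x
      using that d by (auto intro!: less_mult_imp_div_less)
    moreover have "card e = 3"
      using d inj by (auto simp: card_image inj_on_subset)
    ultimately show "e \<in> lift \<S>"
      using d by (auto simp: lift_def image_image) }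
  assume e: "e \<in> lift \<S>"
  \<comment> \<open>The inverse of \<open>?f\<close> on pairs with i < m.\<close>
  define d where "d = (\<lambda>(i, t). i + m * t) ` e"
  have lt: "fst x < m \<and> snd x < 3" if "x \<in> e" for x
    using e that assms by (fastforce simp: lift_def)
  have ed: "?f ` d = e"
  proof -
    have "?f ` d = (\<lambda>x. x) ` e"
      unfolding d_def image_image using lt by (intro image_cong) fastforce+
    then show ?thesis by simp
  qed
  then have "card d = 3"
    using e inj card_image[of ?f d] by (simp add: lift_def inj_on_subset)
  moreover have "d \<subseteq> {..<3 * m}"
  proof
    fix y assume "y \<in> d"
    then obtain x where x: "x \<in> e" "y = fst x + m * snd x" by (auto simp: d_def)
    then have "m * snd x \<le> m * 2" using lt[of x] by (intro mult_left_mono) auto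
    then show "y \<in> {..<3 * m}" using x lt[of x] unfolding lessThan_iff by linarith
  qed
  moreover have "(\<lambda>x. x mod m) ` d \<in> \<S>"
    using e unfolding ed[symmetric] lift_def by (simp add: image_image)
  ultimately show "e \<in> (`) ?f ` ?E"
    using ed by blast
qed

lemma gadget_good:
  assumes "gadget m Ss cs"
  shows "good (set ` set Ss)"
proof -
  define es where "es = concat (map cycle_triples cs)"
  define ts where "ts = filter (supported_in m Ss) (sorted_triples (3 * m))"
  have Ss: "\<forall>S\<in>set Ss. sorted S \<and> distinct S \<and> set S \<subseteq> {..<m}"
    and cs: "\<forall>c\<in>set cs. is_tight_cycle 9 c \<and> set c \<subseteq> {..<3 * m}"
    and es: "distinct es" "\<forall>e\<in>set es. supported_in m Ss e" "length es = length ts"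
    using assms by (auto simp: gadget_def list_all_iff is_tight_cycle_def es_def ts_def Let_def)
  have supp: "supported_in m Ss e \<longleftrightarrow> (\<lambda>x. x mod m) ` set e \<in> set ` set Ss" for e
  proof
    assume "(\<lambda>x. x mod m) ` set e \<in> set ` set Ss"
    then obtain S where S: "S \<in> set Ss" "(\<lambda>x. x mod m) ` set e = set S" by auto
    then have "S = remdups (sort (map (\<lambda>x. x mod m) e))"
      using Ss by (intro sorted_distinct_set_unique) simp_all
    with S show "supported_in m Ss e" by (simp add: supported_in_def)
  next
    assume "supported_in m Ss e"
    then have "set (remdups (sort (map (\<lambda>x. x mod m) e))) \<in> set ` set Ss"
      unfolding supported_in_def by (rule imageI)
    then show "(\<lambda>x. x mod m) ` set e \<in> set ` set Ss" by simp
  qed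
  have "set es \<subseteq> set ts"
    using es(2) cs cycle_triples_sorted unfolding ts_def es_def
    by (fastforce simp: set_sorted_triples)
  \<comment> \<open>\<open>es\<close> is distinct, so its length is the cardinality of its set; the
    equal length of \<open>ts\<close> bounds the other cardinality from above. Together with the
    inclusion this forces equality.\<close>
  moreover have "card (set ts) \<le> card (set es)"
    using es by (metis card_length distinct_card)
  ultimately have "set es = set ts"
    by (intro card_seteq) auto
  moreover have "decomposable (set ` set es)"
    unfolding es_def using cs es(1) by (intro decomposable_cycle_triples) (auto simp: es_def)
  moreover have "set ` set ts = {e. card e = 3 \<and> e \<subseteq> {..<3 * m} \<and> (\<lambda>x. x mod m) ` e \<in> set ` set Ss}"
    (is "_ = ?E")
  proof (intro subset_antisym subsetI)
    fix e assume e: "e \<in> ?E"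
    then have "finite e" by (auto intro: finite_subset)
    then have "e = set (sorted_list_of_set e)" "sorted_list_of_set e \<in> set ts"
      using e by (auto simp: ts_def supp set_sorted_triples)
    then show "e \<in> set ` set ts" by blast
  qed (auto simp: ts_def supp set_sorted_triples distinct_card)
  ultimately have dec: "decomposable ?E" by simp
  have inj: "inj (\<lambda>x. (x mod m, x div m))"
    by (rule injI) (metis Pair_inject div_mult_mod_eq)
  have "\<Union> (set ` set Ss) \<subseteq> {..<m}" using Ss by auto
  then show ?thesis
    unfolding good_def using decomposable_image[OF dec inj_on_subset[OF inj subset_UNIV]]
    by (simp only: lift_conv_image)
qed


section \<open>The explicit gadgets and their transfer to arbitrary groups\<close>

text \<open>
  The base cycles below were found by computer search; the vertex x stands for the vertex x div m
  of the group x mod m, and the cycles are developed modulo 3 m (cycles fixed by a shift by m have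
  short orbits).
\<close>

lemma good_transversal_base: "good (set ` set [[0, 1, 2 :: nat]])"
  by (rule gadget_good[where m = 3 and cs =
      "[[0, 2, 1, 3, 8, 4, 6, 5, 7], [1, 0, 5, 4, 3, 2, 7, 6, 8], [0, 4, 2, 6, 1, 5, 3, 7, 8]]"])
    code_simp

lemma good_triangle_base: "good (set ` set [[0, 1], [0, 2], [1, 2], [0, 1, 2 :: nat]])"
  by (rule gadget_good[where m = 3 and cs = "shifts 9 [0..<9] [0, 2, 1, 4, 8, 7, 3, 5, 6]"])
    code_simp

lemma good_four_base:
  "good (set ` set [[0, 1], [0, 2], [0, 3], [1, 2], [1, 3], [2, 3],
    [0, 1, 2], [0, 1, 3], [0, 2, 3], [1, 2, 3 :: nat]])"
  by (rule gadget_good[where m = 4 and cs =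
      "shifts 12 [0..<12] [0, 2, 1, 7, 9, 3, 6, 5, 10] @
       shifts 12 [0..<12] [0, 3, 1, 6, 7, 2, 5, 9, 8]"])
    code_simp

text \<open>Only the pair {1, 3} is missing. Odd shifts would move it to {0, 2}, so the cycles are
  developed by even shifts only; 22 cycles cover the 198 edges.\<close>

lemma good_holed_base:
  "good (set ` set [[0, 1], [0, 2], [0, 3], [1, 2], [2, 3],
    [0, 1, 2], [0, 1, 3], [0, 2, 3], [1, 2, 3 :: nat]])"
  by (rule gadget_good[where m = 4 and cs =
      "shifts 12 [0, 2] [9, 4, 7, 5, 0, 3, 1, 8, 11] @
       shifts 12 [0, 2] [10, 4, 1, 6, 0, 9, 2, 8, 5] @
       shifts 12 [0, 2, 4, 6, 8, 10] [1, 0, 2, 6, 11, 8, 7, 5, 10] @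
       shifts 12 [0, 2, 4, 6, 8, 10] [0, 1, 4, 9, 8, 3, 7, 6, 11] @
       shifts 12 [0, 2, 4, 6, 8, 10] [0, 4, 2, 10, 1, 6, 8, 5, 11]"])
    code_simp

text \<open>The missing pairs {0, 2} and {1, 3} are exchanged by a shift by 1, so every shift
  preserves the family; 20 cycles cover the 180 edges.\<close>

lemma good_square_base:
  "good (set ` set [[0, 1], [0, 3], [1, 2], [2, 3],
    [0, 1, 2], [0, 1, 3], [0, 2, 3], [1, 2, 3 :: nat]])"
  by (rule gadget_good[where m = 4 and cs =
      "shifts 12 [0..<4] [9, 4, 7, 5, 0, 3, 1, 8, 11] @
       shifts 12 [0..<4] [1, 3, 6, 5, 7, 10, 9, 11, 2] @
       shifts 12 [0..<12] [0, 1, 4, 7, 8, 3, 2, 9, 5]"])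
    code_simp

text \<open>Group number k of a gadget becomes the k-th entry of \<open>xs\<close>.\<close>

lemma good_nth:
  assumes "good (set ` set Ss)" "\<forall>S\<in>set Ss. \<forall>i\<in>set S. i < length xs" "distinct xs"
  shows "good ((\<lambda>S. (!) xs ` set S) ` set Ss)"
proof -
  have "inj_on ((!) xs) (\<Union> (set ` set Ss))"
    using assms(2,3) by (auto simp: inj_on_def nth_eq_iff_index_eq)
  from good_image[OF assms(1) this] show ?thesis
    by (simp only: image_image)
qed

lemma good_transversal:
  assumes "distinct [a, b, c]"
  shows "good {{a, b, c}}"
  using good_nth[OF good_transversal_base _ assms] by simp

lemma good_triangle:
  assumes "distinct [a, b, c]"
  shows "good {{a, b}, {a, c}, {b, c}, {a, b, c}}"
  using good_nth[OF good_triangle_base _ assms] by simp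

lemma good_four:
  assumes "distinct [a, b, c, d]"
  shows "good {{a, b}, {a, c}, {a, d}, {b, c}, {b, d}, {c, d}, {a, b, c}, {a, b, d}, {a, c, d}, {b, c, d}}"
  using good_nth[OF good_four_base _ assms] by simp

text \<open>The order a, i, b, j puts i and j at positions 1 and 3, the missing pair of the base
  gadget.\<close>

lemma good_holed:
  assumes "distinct [a, i, b, j]"
  shows "good {{a, i}, {a, b}, {a, j}, {i, b}, {b, j}, {a, i, b}, {a, i, j}, {a, b, j}, {i, b, j}}"
  using good_nth[OF good_holed_base _ assms] by simp

lemma good_square:
  assumes "distinct [a, i, b, j]"
  shows "good {{a, i}, {a, j}, {i, b}, {b, j}, {a, i, b}, {a, i, j}, {a, b, j}, {i, b, j}}"
  using good_nth[OF good_square_base _ assms] by simp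

section \<open>Induction on the number of groups\<close>

lemma good_triples:
  assumes "finite \<T>" "\<And>S. S \<in> \<T> \<Longrightarrow> card S = 3"
  shows "good \<T>"
  using assms
proof (induction rule: finite_induct)
  case (insert S \<T>)
  then obtain a b c where "S = {a, b, c}" "distinct [a, b, c]"
    by (metis card_3_iff distinct_length_2_or_more distinct_singleton insertI1)
  then have "good {S}"
    using good_transversal by metis
  then have "good ({S} \<union> \<T>)"
    using insert by (intro good_Un) simp_all
  then show ?case by simp
qed (rule good_empty)

text \<open>Each 3-set is good by itself, so leftover 3-sets can always be added; only the 2-sets
  need planning.\<close>

lemma good_superset:
  assumes "good \<S>" "\<S> \<subseteq> \<U>" "finite \<U>" "\<And>S. S \<in> \<U> - \<S> \<Longrightarrow> card S = 3"
  shows "good \<U>"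
proof -
  have "good (\<S> \<union> (\<U> - \<S>))"
    using assms by (intro good_Un good_triples[of "\<U> - \<S>"]) auto
  with assms(2) show ?thesis by (simp add: Un_absorb1)
qed

text \<open>These are the supports of the edges outside I: an edge meeting a single group is that
  group.\<close>

definition supports :: "'i set \<Rightarrow> 'i set set" where
  "supports A = {S. S \<subseteq> A \<and> (card S = 2 \<or> card S = 3)}"

lemma finite_supports: "finite A \<Longrightarrow> finite (supports A)"
  by (simp add: supports_def)

lemma supports_mono: "A \<subseteq> B \<Longrightarrow> supports A \<subseteq> supports B"
  unfolding supports_def by blast

text \<open>One copy of \<open>good_square\<close> joins a and b to each successive pair of old
  groups. Requiring every support to meet both sides is what later separates this family from the
  others.\<close>

lemma good_bipartite:
  fixes a b l :: nat
  assumes "a \<noteq> b" "a \<notin> {l..<l + 2 * m}" "b \<notin> {l..<l + 2 * m}"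
  shows "\<exists>\<S>. good \<S> \<and> \<S> \<subseteq> supports ({a, b} \<union> {l..<l + 2 * m}) \<and>
    (\<forall>S\<in>\<S>. S \<inter> {a, b} \<noteq> {} \<and> S \<inter> {l..<l + 2 * m} \<noteq> {}) \<and>
    (\<forall>x\<in>{a, b}. \<forall>y\<in>{l..<l + 2 * m}. {x, y} \<in> \<S>)"
  using assms(2,3)
proof (induction m)
  case 0
  show ?case by (intro exI[of _ "{}"]) (simp add: good_empty)
next
  case (Suc m)
  define i j where "i = l + 2 * m" and "j = Suc i"
  have interval: "{l..<l + 2 * Suc m} = {l..<l + 2 * m} \<union> {i, j}"
    and new: "i \<notin> {l..<l + 2 * m}" "j \<notin> {l..<l + 2 * m}" "i \<noteq> j"
    by (auto simp: i_def j_def)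
  have ne: "a \<noteq> i" "a \<noteq> j" "b \<noteq> i" "b \<noteq> j" "a \<notin> {l..<l + 2 * m}" "b \<notin> {l..<l + 2 * m}"
    using Suc.prems unfolding interval by blast+
  let ?A = "{l..<l + 2 * m}"
  from Suc.IH[OF ne(5,6)] obtain \<S> where \<S>: "good \<S>" "\<S> \<subseteq> supports ({a, b} \<union> ?A)"
    "\<forall>S\<in>\<S>. S \<inter> {a, b} \<noteq> {} \<and> S \<inter> ?A \<noteq> {}" "\<forall>x\<in>{a, b}. \<forall>y\<in>?A. {x, y} \<in> \<S>"
    by (elim exE conjE) (rule that)
  obtain \<T> where \<T>: "good \<T>" "\<T> \<subseteq> supports ({a, b} \<union> {i, j})"
    "\<forall>S\<in>\<T>. S \<inter> {a, b} \<noteq> {} \<and> S \<inter> {i, j} \<noteq> {}" "\<forall>x\<in>{a, b}. \<forall>y\<in>{i, j}. {x, y} \<in> \<T>"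
  proof
    let ?\<T> = "{{a, i}, {a, j}, {i, b}, {b, j}, {a, i, b}, {a, i, j}, {a, b, j}, {i, b, j}}"
    show "good ?\<T>" using assms(1) ne new by (intro good_square) simp
    show "?\<T> \<subseteq> supports ({a, b} \<union> {i, j})"
      using assms(1) ne new by (simp add: supports_def card_insert_if)
    show "\<forall>S\<in>?\<T>. S \<inter> {a, b} \<noteq> {} \<and> S \<inter> {i, j} \<noteq> {}" by simp
    show "\<forall>x\<in>{a, b}. \<forall>y\<in>{i, j}. {x, y} \<in> ?\<T>" by (simp add: insert_commute)
  qed
  \<comment> \<open>The earlier supports avoid the new pair, while every set in \<T> meets
    it.\<close>
  have "S \<inter> {i, j} = {}" if "S \<in> \<S>" for S
  proof -
    have "S \<subseteq> {a, b} \<union> ?A" using that \<S>(2) unfolding supports_def by blast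
    with new ne show ?thesis by blast
  qed
  then have "good (\<S> \<union> \<T>)"
    using \<T>(3) by (intro good_Un \<S> \<T>) blast
  moreover have "\<S> \<union> \<T> \<subseteq> supports ({a, b} \<union> {l..<l + 2 * Suc m})"
    unfolding interval
    by (intro Un_least subset_trans[OF \<S>(2)] subset_trans[OF \<T>(2)] supports_mono) auto
  moreover have "\<forall>S\<in>\<S> \<union> \<T>. S \<inter> {a, b} \<noteq> {} \<and> S \<inter> {l..<l + 2 * Suc m} \<noteq> {}"
    using \<S>(3) \<T>(3) unfolding interval by blast
  moreover have "\<forall>x\<in>{a, b}. \<forall>y\<in>{l..<l + 2 * Suc m}. {x, y} \<in> \<S> \<union> \<T>"
    using \<S>(4) \<T>(4) unfolding interval by blast
  ultimately show ?case by blast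
qed

text \<open>The new groups are n and n + 1. The family \<T> treats them together with the first l
  old groups, \<open>good_bipartite\<close> joins them to the remaining 2m, and leftover 3-sets are
  added at the end.\<close>

lemma good_supports_step:
  fixes l m :: nat
  defines "n \<equiv> l + 2 * m"
  assumes "good (supports {..<n})"
    and \<T>: "good \<T>" "\<T> \<subseteq> supports ({n, n + 1} \<union> {..<l})" "\<forall>S\<in>\<T>. S \<inter> {n, n + 1} \<noteq> {}"
    and pairs: "{n, n + 1} \<in> \<T>" "\<forall>x\<in>{n, n + 1}. \<forall>y<l. {x, y} \<in> \<T>"
  shows "good (supports {..<n + 2})"
proof -
  obtain \<S> where \<S>: "good \<S>" "\<S> \<subseteq> supports ({n, n + 1} \<union> {l..<n})"
    "\<forall>S\<in>\<S>. S \<inter> {n, n + 1} \<noteq> {} \<and> S \<inter> {l..<n} \<noteq> {}" "\<forall>x\<in>{n, n + 1}. \<forall>y\<in>{l..<n}. {x, y} \<in> \<S>"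
    using good_bipartite[of n "n + 1" l m] unfolding n_def by auto
  have "S \<inter> {l..<n} = {}" if "S \<in> \<T>" for S
  proof -
    have "S \<subseteq> {n, n + 1} \<union> {..<l}" using that \<T>(2) unfolding supports_def by blast
    moreover have "({n, n + 1} \<union> {..<l}) \<inter> {l..<n} = {}" by auto
    ultimately show ?thesis by blast
  qed
  then have "good (\<S> \<union> \<T>)"
    using \<S>(3) by (intro good_Un \<S>(1) \<T>(1)) blast
  moreover have "supports {..<n} \<inter> (\<S> \<union> \<T>) = {}"
  proof (rule equals0I)
    fix S assume S: "S \<in> supports {..<n} \<inter> (\<S> \<union> \<T>)"
    then have "S \<subseteq> {..<n}" by (simp add: supports_def)
    moreover have "S \<inter> {n, n + 1} \<noteq> {}" using S \<S>(3) \<T>(3) by blast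
    ultimately show False by auto
  qed
  ultimately have "good (supports {..<n} \<union> (\<S> \<union> \<T>))"
    by (rule good_Un[OF assms(2)])
  then show ?thesis
  proof (rule good_superset)
    show "supports {..<n} \<union> (\<S> \<union> \<T>) \<subseteq> supports {..<n + 2}"
      by (intro Un_least subset_trans[OF \<S>(2)] subset_trans[OF \<T>(2)] supports_mono) (auto simp: n_def)
    show "finite (supports {..<n + 2})"
      by (simp add: finite_supports)
    fix S assume S: "S \<in> supports {..<n + 2} - (supports {..<n} \<union> (\<S> \<union> \<T>))"
    show "card S = 3"
    proof (rule ccontr)
      assume "card S \<noteq> 3"
      with S have "card S = 2" by (simp add: supports_def)
      then obtain x y where xy: "S = {y, x}" "x < y"
        by (metis card_2_iff insert_commute linorder_neqE_nat)
      \<comment> \<open>The larger element must be a new group, as otherwise S would lie in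
        \<open>supports {..<n}\<close>. The smaller one is then among the first l groups, among the
        other old ones, or the other new group.\<close>
      have "y < n + 2" "\<not> y < n"
        using S xy \<open>card S = 2\<close> by (auto simp: supports_def)
      then have "y \<in> {n, n + 1}" by auto
      moreover have "x < l \<or> x \<in> {l..<n} \<or> x = n \<and> y = n + 1"
        using calculation xy(2) by auto
      ultimately have "S \<in> \<S> \<union> \<T>"
        using xy(1) \<S>(4) pairs by (metis UnCI insert_commute)
      with S show False by simp
    qed
  qed
qed

text \<open>The step is applied with l = 1: group 0 is the unpaired one.\<close>

lemma good_supports_odd: "good (supports {..<1 + 2 * m :: nat})"
proof (induction m)
  case 0
  have "S \<notin> supports {..<1::nat}" for S
    using card_mono[of "{..<1::nat}" S] by (auto simp: supports_def)
  then have "supports {..<1::nat} = {}" by blast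
  then show ?case by (simp add: good_empty)
next
  case (Suc m)
  let ?n = "1 + 2 * m"
  let ?\<T> = "{{?n, ?n + 1}, {?n, 0}, {?n + 1, 0}, {?n, ?n + 1, 0}}"
  have "good (supports {..<?n + 2})"
  proof (rule good_supports_step[where \<T> = ?\<T>, OF Suc])
    show "good ?\<T>" by (rule good_triangle) simp
    show "?\<T> \<subseteq> supports ({?n, ?n + 1} \<union> {..<1})" by (simp add: supports_def)
  qed simp_all
  then show ?case by simp
qed

text \<open>The step is applied with l = 2: the missing pair of \<open>good_holed\<close> is {0, 1},
  which the induction hypothesis already covers. The base case is four groups.\<close>

lemma good_supports_even: "good (supports {..<2 + 2 * Suc m :: nat})"
proof (induction m)
  case 0
  let ?\<T> = "{{0, 1}, {0, 2}, {0, 3}, {1, 2}, {1, 3}, {2, 3}, {0, 1, 2}, {0, 1, 3}, {0, 2, 3}, {1, 2, 3::nat}}"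
  have "good ?\<T>"
    by (rule good_four) simp
  then have "good (supports {..<4::nat})"
  proof (rule good_superset)
    show "?\<T> \<subseteq> supports {..<4}" by (simp add: supports_def)
    show "finite (supports {..<4::nat})" by (simp add: finite_supports)
    fix S assume S: "S \<in> supports {..<4} - ?\<T>"
    show "card S = 3"
    proof (rule ccontr)
      assume "card S \<noteq> 3"
      with S have "card S = 2" by (simp add: supports_def)
      then obtain x y where xy: "S = {x, y}" "x < y"
        by (metis card_2_iff insert_commute linorder_neqE_nat)
      moreover have "y < 4" using S xy by (simp add: supports_def)
      ultimately have "(x, y) \<in> {(0, 1), (0, 2), (0, 3), (1, 2), (1, 3), (2, 3)}"
        by (simp add: less_Suc_eq numeral_eq_Suc) linarith
      then have "S \<in> ?\<T>"
        unfolding xy(1) by (elim insertE) simp_all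
      with S show False by blast
    qed
  qed
  then show ?case by simp
next
  case (Suc m)
  let ?n = "2 + 2 * Suc m"
  let ?\<T> = "{{?n, 0}, {?n, ?n + 1}, {?n, 1}, {0, ?n + 1}, {?n + 1, 1},
    {?n, 0, ?n + 1}, {?n, 0, 1}, {?n, ?n + 1, 1}, {0, ?n + 1, 1}}"
  have "good (supports {..<?n + 2})"
  proof (rule good_supports_step[where \<T> = ?\<T>, OF Suc])
    show "good ?\<T>" by (rule good_holed) simp
    show "?\<T> \<subseteq> supports ({?n, ?n + 1} \<union> {..<2})" by (simp add: supports_def)
    show "\<forall>x\<in>{?n, ?n + 1}. \<forall>y<2. {x, y} \<in> ?\<T>"
      by (simp add: numeral_2_eq_2 less_Suc_eq insert_commute)
  qed simp_all
  then show ?case by simp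
qed

lemma good_supports:
  fixes n :: nat
  assumes "3 \<le> n"
  shows "good (supports {..<n})"
proof (cases "odd n")
  case True
  then obtain k where "n = 1 + 2 * k" by (auto elim: oddE)
  then show ?thesis using good_supports_odd by metis
next
  case False
  then obtain k where "n = 2 * k" by (auto elim: evenE)
  \<comment> \<open>Here k is at least 2, so the subtraction is not truncated.\<close>
  then have "n = 2 + 2 * Suc (k - 2)" using assms by simp
  then show ?thesis using good_supports_even by metis
qed

section \<open>Transfer to a given 1-factor\<close>

lemma lift_supports_image:
  assumes \<phi>: "bij_betw \<phi> ({..<n} \<times> {..<3}) V"
    and I: "I = (\<lambda>i. \<phi> ` ({i} \<times> {..<3})) ` {..<n}"
  shows "(`) \<phi> ` lift (supports {..<n}) = complete3 V - I"
proof -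
  let ?W = "{..<n} \<times> {..<3::nat}"
  have inj: "inj_on \<phi> ?W" and im: "\<phi> ` ?W = V"
    using \<phi> by (auto simp: bij_betw_def)
  have iff: "d \<in> lift (supports {..<n}) \<longleftrightarrow> \<phi> ` d \<notin> I" if d: "d \<subseteq> ?W" "card d = 3" for d
  proof -
    have fin: "finite d" using d by (metis card.infinite zero_neq_numeral)
    have "card (fst ` d) \<le> 3" using card_image_le[OF fin, of fst] d by simp
    moreover have "card (fst ` d) \<noteq> 0" using d fin by auto
    \<comment> \<open>A 3-set meets one, two or three groups, so it is excluded exactly when it
      meets only one, that is, when it is a whole group.\<close>
    ultimately have "d \<in> lift (supports {..<n}) \<longleftrightarrow> card (fst ` d) \<noteq> 1"
      using d by (fastforce simp: lift_def supports_def)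
    also have "card (fst ` d) = 1 \<longleftrightarrow> (\<exists>i<n. d = {i} \<times> {..<3})"
    proof
      assume "card (fst ` d) = 1"
      then obtain i where i: "fst ` d = {i}" by (auto simp: card_1_singleton_iff)
      have "d \<subseteq> {i} \<times> {..<3}"
      proof
        fix x assume "x \<in> d"
        then have "fst x = i" "snd x < 3" using i d by auto
        then show "x \<in> {i} \<times> {..<3}" by (cases x) simp
      qed
      then have "d = {i} \<times> {..<3}" using d by (intro card_subset_eq) auto
      moreover have "i < n" using i d(1) by (metis (no_types) imageE insertI1 lessThan_iff mem_Times_iff subsetD)
      ultimately show "\<exists>i<n. d = {i} \<times> {..<3}" by blast
    next
      assume "\<exists>i<n. d = {i} \<times> {..<3}"
      then obtain i where "d = {i} \<times> {..<3}" by blast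
      moreover have "fst ` ({i} \<times> {..<3::nat}) = {i}" by (simp add: lessThan_empty_iff)
      ultimately show "card (fst ` d) = 1" by simp
    qed
    also have "(\<exists>i<n. d = {i} \<times> {..<3}) \<longleftrightarrow> \<phi> ` d \<in> I"
    proof -
      have "d = {i} \<times> {..<3} \<longleftrightarrow> \<phi> ` d = \<phi> ` ({i} \<times> {..<3})" if "i < n" for i
        using that d by (intro inj_on_image_eq_iff[OF inj, symmetric]) auto
      then show ?thesis unfolding I by auto
    qed
    finally show ?thesis .
  qed
  have sub: "d \<subseteq> ?W \<and> card d = 3" if "d \<in> lift (supports {..<n})" for d
    using that by (force simp: lift_def supports_def)
  show ?thesis
  proof (intro subset_antisym subsetI)
    fix e assume "e \<in> (`) \<phi> ` lift (supports {..<n})"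
    then obtain d where d: "d \<in> lift (supports {..<n})" "e = \<phi> ` d" by auto
    then have "card e = 3" using sub[OF d(1)] inj by (metis card_image inj_on_subset)
    then show "e \<in> complete3 V - I" using d sub[OF d(1)] iff im by (auto simp: complete3_def)
  next
    fix e assume e: "e \<in> complete3 V - I"
    then obtain d where d: "d \<subseteq> ?W" "e = \<phi> ` d"
      unfolding complete3_def im[symmetric] by (auto simp: subset_image_iff)
    have "card e = 3" using e by (simp add: complete3_def)
    then have "card d = 3"
      using card_image[OF inj_on_subset[OF inj d(1)]] d(2) by simp
    then have "d \<in> lift (supports {..<n})" using iff[OF d(1)] d(2) e by simp
    then show "e \<in> (`) \<phi> ` lift (supports {..<n})" unfolding d(2) by (rule imageI)
  qed
qed

lemma one_factor_coordinates:
  assumes "finite V" "one_factor V I"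
  obtains \<phi> :: "nat \<times> nat \<Rightarrow> 'a" where "bij_betw \<phi> ({..<card I} \<times> {..<3}) V"
    "I = (\<lambda>i. \<phi> ` ({i} \<times> {..<3})) ` {..<card I}"
proof -
  have I: "\<forall>A\<in>I. finite A \<and> card A = 3" "\<forall>A\<in>I. \<forall>B\<in>I. A \<noteq> B \<longrightarrow> A \<inter> B = {}" "\<Union>I = V"
    using assms by (auto simp: one_factor_def complete3_def intro: finite_subset)
  have "finite I" using assms(1) I(3) by (metis finite_UnionD)
  then obtain h where h: "bij_betw h {..<card I} I"
    using ex_bij_betw_nat_finite by (auto simp: lessThan_atLeast0)
  have "\<exists>b. bij_betw b {..<3::nat} A" if "A \<in> I" for A
    using ex_bij_betw_nat_finite[of A] I(1) that by (auto simp: lessThan_atLeast0)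
  then obtain b where b: "\<And>A. A \<in> I \<Longrightarrow> bij_betw (b A) {..<3::nat} A" by metis
  \<comment> \<open>\<open>h\<close> enumerates the triples of I, and \<open>b\<close> enumerates
    the vertices within each triple.\<close>
  define \<phi> where "\<phi> = (\<lambda>(i, t). b (h i) t)"
  have hI: "h i \<in> I" if "i < card I" for i using h that by (auto simp: bij_betw_def)
  have im: "\<phi> ` ({i} \<times> {..<3}) = h i" if "i < card I" for i
  proof -
    have "\<phi> ` ({i} \<times> {..<3}) = b (h i) ` {..<3}" by (auto simp: \<phi>_def)
    then show ?thesis using b[OF hI[OF that]] by (simp add: bij_betw_def)
  qed
  have "inj_on \<phi> ({..<card I} \<times> {..<3})"
  proof (rule inj_onI, clarify)
    fix i t i' t' assume lt: "i < card I" "i' < card I" "t < (3::nat)" "t' < (3::nat)" and eq: "\<phi> (i, t) = \<phi> (i', t')"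
    have "\<phi> (i, t) \<in> h i" "\<phi> (i', t') \<in> h i'" using im lt by auto
    then have "h i = h i'" using I(2) eq hI lt by (metis disjoint_iff)
    then have "i = i'" using h lt by (auto simp: bij_betw_def inj_on_def)
    moreover have "t = t'" using b[OF hI[OF lt(1)]] eq lt \<open>i = i'\<close> by (auto simp: \<phi>_def bij_betw_def inj_on_def)
    ultimately show "i = i' \<and> t = t'" by simp
  qed
  moreover have I_eq: "I = (\<lambda>i. \<phi> ` ({i} \<times> {..<3})) ` {..<card I}"
    using h im by (auto simp: bij_betw_def)
  moreover have "\<phi> ` ({..<card I} \<times> {..<3}) = V"
  proof -
    have "\<phi> ` ({..<card I} \<times> {..<3}) = (\<Union>i<card I. \<phi> ` ({i} \<times> {..<3}))" by auto
    also have "\<dots> = V" using I_eq I(3) by simp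
    finally show ?thesis .
  qed
  ultimately show thesis using that by (auto simp: bij_betw_def)
qed

theorem theorem3:
  fixes v :: nat and I :: "nat set set"
  assumes "v \<ge> 4" and "3 dvd v" and "one_factor {0..<v} I"
  shows "(\<exists>Cs. cycle_decomposition 9 {0..<v} (complete3 {0..<v} - I) Cs) \<longleftrightarrow> v \<ge> 9"
proof
  assume "\<exists>Cs. cycle_decomposition 9 {0..<v} (complete3 {0..<v} - I) Cs"
  then obtain Cs where Cs: "cycle_decomposition 9 {0..<v} (complete3 {0..<v} - I) Cs" ..
  \<comment> \<open>Two distinct triples sharing a vertex cannot both lie in I, so some edge remains
    and there is at least one cycle, which needs nine distinct vertices.\<close>
  define A B :: "nat set" where "A = {0, 1, 2}" and "B = {0, 1, 3}"
  have AB: "2 \<in> A" "2 \<notin> B" "0 \<in> A" "0 \<in> B"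
    by (simp_all add: A_def B_def)
  have "A \<notin> I \<or> B \<notin> I"
    using AB assms(3) unfolding one_factor_def by blast
  moreover have "A \<in> complete3 {0..<v}" "B \<in> complete3 {0..<v}"
    using assms(1) by (simp_all add: complete3_def A_def B_def)
  ultimately have "complete3 {0..<v} - I \<noteq> {}" by blast
  moreover have "(\<Union>c\<in>set Cs. cycle_edges c) = complete3 {0..<v} - I"
    using Cs unfolding cycle_decomposition_def by (elim conjE)
  ultimately obtain c where "c \<in> set Cs" by (metis UN_empty empty_set equals0I)
  then have "is_tight_cycle 9 c" "set c \<subseteq> {0..<v}"
    using Cs unfolding cycle_decomposition_def by simp_all
  then have "card (set c) = 9" and "card (set c) \<le> v"
    using card_mono[of "{0..<v}" "set c"] by (simp_all add: is_tight_cycle_def distinct_card)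
  then show "v \<ge> 9" by simp
next
  assume "v \<ge> 9"
  obtain \<phi> :: "nat \<times> nat \<Rightarrow> nat" where \<phi>: "bij_betw \<phi> ({..<card I} \<times> {..<3}) {0..<v}"
    "I = (\<lambda>i. \<phi> ` ({i} \<times> {..<3})) ` {..<card I}"
    using one_factor_coordinates[OF _ assms(3)] by auto
  \<comment> \<open>Thus v \<ge> 9 means at least three groups, as \<open>good_supports\<close>
    requires.\<close>
  have "v = 3 * card I" using bij_betw_same_card[OF \<phi>(1)] by simp
  with \<open>v \<ge> 9\<close> have "decomposable (lift (supports {..<card I}))"
    using good_supports[of "card I"] by (simp add: good_def)
  moreover have "\<Union> (lift (supports {..<card I})) \<subseteq> {..<card I} \<times> {..<3}"
    using Union_lift[of "supports {..<card I}"] by (fastforce simp: supports_def)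
  ultimately have "decomposable ((`) \<phi> ` lift (supports {..<card I}))"
    using \<phi>(1) by (auto simp: bij_betw_def intro: decomposable_image inj_on_subset)
  then show "\<exists>Cs. cycle_decomposition 9 {0..<v} (complete3 {0..<v} - I) Cs"
    unfolding lift_supports_image[OF \<phi>] by (intro decomposable_imp_cycle_decomposition) auto
qed

end
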